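(* Let $m,q,k\ge 1$, let $d$ be a positive divisor of $m$, and let $s$ be a linear sequence with $(s)\in\mathcal{C}^{(d)}(m,q,k)$. Then $\mathrm{BWT}(s)$ has the form $a_1^{\,d}a_2^{\,d}\cdots a_r^{\,d}$ where $a_1a_2\cdots a_r\in(\mathcal{P}_{m/d,q})^{q^{k-1}}\cap\mathcal{N}$.
   Context: Let $\Omega=\{0,1,\ldots,q-1\}$ with the usual order; a $k$-mer is an element of $\Omega^k$. For $s=a_1\ldots a_n$, $\rho(a_1\ldots a_n)=a_na_1\ldots a_{n-1}$; the cyclic sequence $(s)$ is the set of rotations of $s$. The number of occurrences of a $k$-mer $y$ in $(a_1\ldots a_n)$ is the number of $i\in\{1,\ldots,n\}$ with $a_i\cdots a_{i+k-1}=y$, indices modulo $n$ (positions may be reused if $k>n$). A cyclic multi de Bruijn sequence with parameters $(m,q,k)$ is a cyclic sequence over $\Omega$ in which every $k$-mer occurs exactly $m$ times. The order of $(s)$, $|s|=n$, is the largest positive divisor $d$ of $n$ with $\rho^{n/d}(s)=s$; $\mathcal{C}^{(d)}(m,q,k)$ is the set of cyclic multi de Bruijn sequences with parameters $(m,q,k)$ of order $d$. Burrows–Wheeler Transform: for $s\in\Omega^n$, sort the $n$ rotations $\rho^0(s),\ldots,\rho^{n-1}(s)$ (with repetitions) lexicographically as rows of an $n\times n$ table; $\mathrm{BWT}(s)$ is the last column read top to bottom. $a^d$ for a letter $a$ is $d$ copies of $a$. $\mathcal{P}_{m',q}$ is the set of words of length $m'q$ over $\Omega$ in which each symbol occurs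 exactly $m'$ times; $(\mathcal{P}_{m',q})^{q^{k-1}}$ is the set of concatenations of $q^{k-1}$ words from $\mathcal{P}_{m',q}$. $\mathcal{N}$ is the set of nonempty words $w$ over $\Omega$ that are not of the form $b_1^{\,i}b_2^{\,i}\cdots b_j^{\,i}$ (letters $b_1,\ldots,b_j$) for any $i>1$. *)

theory Defs
  imports Main "HOL-Library.List_Lexorder"
begin

definition alphabet :: "nat \<Rightarrow> nat set" where
  "alphabet q = {0..<q}"

definition kmers :: "nat \<Rightarrow> nat \<Rightarrow> nat list set" where
  "kmers q k = {y. set y \<subseteq> alphabet q \<and> length y = k}"

(* Rotation to the right: the last letter moves to the front (the library's rotate1 goes left). *)
definition rho :: "'a list \<Rightarrow> 'a list" where
  "rho s = (if s = [] then [] else last s # butlast s)"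

definition cyclic_seq :: "'a list \<Rightarrow> 'a list set" where
  "cyclic_seq s = {(rho ^^ i) s | i. True}"

(* Number of cyclic occurrences of y in s. It depends only on the rotation class of s. *)
definition occurrences :: "'a list \<Rightarrow> 'a list \<Rightarrow> nat" where
  "occurrences y s =
     card {i. i < length s \<and> map (\<lambda>j. s ! ((i + j) mod length s)) [0..<length y] = y}"

(* For nonempty s; the set is finite and contains 1. It depends only on the rotation class of s. *)
definition cyclic_order :: "'a list \<Rightarrow> nat" where
  "cyclic_order s =
     Max {d. 0 < d \<and> d dvd length s \<and> (rho ^^ (length s div d)) s = s}"

definition multi_de_bruijn :: "nat \<Rightarrow> nat \<Rightarrow> nat \<Rightarrow> nat list set set" where
  "multi_de_bruijn m q k =
     {cyclic_seq s | s. set s \<subseteq> alphabet q \<and> (\<forall>y\<in>kmers q k. occurrences y s = m)}"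

definition multi_de_bruijn_of_order :: "nat \<Rightarrow> nat \<Rightarrow> nat \<Rightarrow> nat \<Rightarrow> nat list set set" where
  "multi_de_bruijn_of_order d m q k =
     {cyclic_seq s | s. cyclic_seq s \<in> multi_de_bruijn m q k \<and> cyclic_order s = d}"

(* The order on lists used by sort is the lexicographic one from List_Lexorder. *)
definition bwt :: "nat list \<Rightarrow> nat list" where
  "bwt s = map last (sort (map (\<lambda>i. (rho ^^ i) s) [0..<length s]))"

(* letter_power d (a1 ... ar) is the word a1^d ... ar^d. *)
definition letter_power :: "nat \<Rightarrow> 'a list \<Rightarrow> 'a list" where
  "letter_power d w = concat (map (replicate d) w)"

definition balanced_words :: "nat \<Rightarrow> nat \<Rightarrow> nat list set" where
  "balanced_words m q =
     {w. set w \<subseteq> alphabet q \<and> length w = m * q \<and> (\<forall>a\<in>alphabet q. count_list w a = m)}"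

definition concat_power :: "'a list set \<Rightarrow> nat \<Rightarrow> 'a list set" where
  "concat_power L t = {concat ws | ws. length ws = t \<and> set ws \<subseteq> L}"

definition non_letter_powers :: "nat \<Rightarrow> nat list set" where
  "non_letter_powers q =
     {w. w \<noteq> [] \<and> set w \<subseteq> alphabet q \<and>
         \<not> (\<exists>i>1. \<exists>b. set b \<subseteq> alphabet q \<and> w = letter_power i b)}"

end

theory Submission
  imports Defs "HOL-Library.Multiset" "HOL-Combinatorics.Cycles"
begin

text \<open>
  The sorted table of rotations contains every row exactly \<open>d\<close> times, where \<open>d\<close> is the order, so
  it is a letter power with exponent \<open>d\<close>, and hence so is its last column. Rows with a common
  prefix \<open>x\<close> of length \<open>k - 1\<close> are consecutive, and rotating such a row that ends in \<open>c\<close> yields a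
  row starting with the \<open>k\<close>-mer \<open>c x\<close>; thus each letter \<open>c\<close> ends exactly \<open>m\<close> of them, which
  gives the balanced blocks.

  If the reduced word were a letter power with exponent \<open>i > 1\<close>, then the Burrows--Wheeler
  transform would be one with exponent \<open>e = d i\<close>. The transform determines the table: the sorted
  list of prefixes of length \<open>l + 1\<close> is obtained by prepending the transform letterwise to the
  sorted list of prefixes of length \<open>l\<close> and sorting again. Each of these steps preserves letter
  powers with exponent \<open>e\<close>, so every row would occur a multiple of \<open>e > d\<close> times.
\<close>

subsection \<open>Letter powers\<close>

lemma letter_power_Nil [simp]: "letter_power d [] = []"
  and letter_power_Cons [simp]: "letter_power d (x # xs) = replicate d x @ letter_power d xs"
  and letter_power_append [simp]:
    "letter_power d (xs @ ys) = letter_power d xs @ letter_power d ys"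
  by (simp_all add: letter_power_def)

lemma letter_power_replicate: "letter_power d (replicate n x) = replicate (d * n) x"
  by (induction n) (simp_all add: replicate_add)

lemma length_letter_power [simp]: "length (letter_power d xs) = d * length xs"
  by (induction xs) simp_all

lemma set_letter_power_subset: "set (letter_power d xs) \<subseteq> set xs"
  by (induction xs) auto

lemma mset_letter_power [simp]: "mset (letter_power d xs) = repeat_mset d (mset xs)"
  by (induction xs) simp_all

lemma letter_power_letter_power:
  "letter_power d (letter_power i xs) = letter_power (d * i) xs"
  by (induction xs) (simp_all add: letter_power_replicate)

lemma map_letter_power: "map f (letter_power d xs) = letter_power d (map f xs)"
  by (induction xs) simp_all

lemma filter_letter_power: "filter P (letter_power d xs) = letter_power d (filter P xs)"
  by (induction xs) simp_all

lemma map2_letter_power: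
  "length xs = length ys \<Longrightarrow>
    map2 f (letter_power d xs) (letter_power d ys) = letter_power d (map2 f xs ys)"
  by (induction xs ys rule: list_induct2) simp_all

lemma sorted_letter_power:
  fixes xs :: "'a::linorder list"
  shows "sorted xs \<Longrightarrow> sorted (letter_power d xs)"
  by (induction xs) (auto simp: sorted_append dest: subsetD[OF set_letter_power_subset])

lemma sort_letter_power:
  fixes xs :: "'a::linorder list"
  shows "sort (letter_power d xs) = letter_power d (sort xs)"
  by (rule properties_for_sort) (simp_all add: sorted_letter_power)

lemma sort_eq_letter_power:
  fixes xs :: "'a::linorder list"
  assumes "\<And>x. x \<in> set xs \<Longrightarrow> count (mset xs) x = d"
  shows "sort xs = letter_power d (sorted_list_of_set (set xs))"
proof (rule properties_for_sort)
  have "mset (sorted_list_of_set (set xs)) = mset_set (set xs)"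
    by (metis mset_sorted_list_of_multiset sorted_list_of_mset_set)
  then show "mset (letter_power d (sorted_list_of_set (set xs))) = mset xs"
    by (intro multiset_eqI) (simp add: assms count_mset_set')
qed (simp add: sorted_letter_power)

subsection \<open>Rotations\<close>

definition rotations :: "'a list \<Rightarrow> 'a list list" where
  "rotations s = map (\<lambda>i. (rho ^^ i) s) [0..<length s]"

lemma rho_rotate1 [simp]: "rho (rotate1 s) = s"
  by (cases s) (simp_all add: rho_def)

lemma rotate1_rho [simp]: "rotate1 (rho s) = s"
  by (simp add: rho_def)

lemma length_rho [simp]: "length (rho s) = length s"
  by (simp add: rho_def)

lemma length_rho_funpow [simp]: "length ((rho ^^ i) s) = length s"
  by (induction i) simp_all

lemma set_rho [simp]: "set (rho s) = set s"
  by (metis rotate1_rho set_rotate1)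

lemma set_rho_funpow [simp]: "set ((rho ^^ i) s) = set s"
  by (induction i) simp_all

lemma inj_rho_funpow: "inj (rho ^^ i)"
  by (intro inj_fn) (metis injI rotate1_rho)

lemma rho_funpow_rotate [simp]: "(rho ^^ i) (rotate i s) = s"
  by (induction i arbitrary: s) (simp_all add: funpow_swap1)

lemma rho_funpow_conv_rotate:
  assumes "i \<le> length s"
  shows "(rho ^^ i) s = rotate (length s - i) s"
proof -
  have "(rho ^^ i) s = (rho ^^ i) (rotate i (rotate (length s - i) s))"
    using assms by (simp add: rotate_rotate)
  then show ?thesis by simp
qed

lemma rho_funpow_length [simp]: "(rho ^^ length s) s = s"
  by (simp add: rho_funpow_conv_rotate)

lemma length_rotations [simp]: "length (rotations s) = length s"
  by (simp add: rotations_def)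

lemma set_rotations: "set (rotations s) = (if s = [] then {} else cyclic_seq s)"
proof (cases "s = []")
  case False
  have "(rho ^^ i) s \<in> set (rotations s)" for i
  proof -
    have "(rho ^^ i) s = (rho ^^ (i mod length s)) s"
      by (simp add: funpow_mod_eq)
    with False show ?thesis by (auto simp: rotations_def)
  qed
  with False show ?thesis by (auto simp: rotations_def cyclic_seq_def)
qed (simp add: rotations_def)

lemma set_of_cyclic_seq: "r \<in> cyclic_seq s \<Longrightarrow> set r = set s"
  by (auto simp: cyclic_seq_def)

lemma self_in_cyclic_seq: "s \<in> cyclic_seq s"
  unfolding cyclic_seq_def by (auto intro: exI[of _ 0])

lemma length_of_rotation: "r \<in> set (rotations s) \<Longrightarrow> length r = length s"
  by (auto simp: rotations_def)

lemma set_of_rotation: "r \<in> set (rotations s) \<Longrightarrow> set r = set s"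
  by (auto simp: rotations_def)

lemma Nil_notin_rotations [simp]: "[] \<notin> set (rotations s)"
  using length_of_rotation[of "[]" s] by (cases s) (auto simp: rotations_def)

lemma rotations_rho: "rotations (rho s) = map rho (rotations s)"
  by (simp add: rotations_def funpow_swap1)

lemma map_rho_rotations: "map rho (rotations s) = rotate1 (rotations s)"
proof (rule nth_equalityI)
  fix i assume "i < length (map rho (rotations s))"
  then have "i < length s" by simp
  then have "Suc i mod length s < length s" by (cases s) auto
  with \<open>i < length s\<close> show "map rho (rotations s) ! i = rotate1 (rotations s) ! i"
    by (simp add: nth_rotate1 rotations_def funpow_mod_eq)
qed simp

lemma mset_map_rho_rotations: "mset (map rho (rotations s)) = mset (rotations s)"
proof -
  have "mset (rotate1 xs) = mset xs" for xs :: "'a list list"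
    by (cases xs) simp_all
  then show ?thesis by (simp only: map_rho_rotations)
qed

lemma mset_rotations_cyclic_seq:
  assumes "r \<in> cyclic_seq s"
  shows "mset (rotations r) = mset (rotations s)"
proof -
  have "mset (rotations ((rho ^^ i) s)) = mset (rotations s)" for i
    by (induction i) (simp_all add: rotations_rho mset_map_rho_rotations del: mset_map)
  with assms show ?thesis by (auto simp: cyclic_seq_def)
qed

lemma rev_map_rho_rotations:
  "rev (map rho (rotations s)) = map (\<lambda>i. rotate i s) [0..<length s]"
proof (rule nth_equalityI)
  fix i assume "i < length (rev (map rho (rotations s)))"
  then have "i < length s" by simp
  then have "rev (map rho (rotations s)) ! i = (rho ^^ Suc (length s - Suc i)) s"
    by (simp add: rev_nth rotations_def)
  also have "Suc (length s - Suc i) = length s - i"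
    using \<open>i < length s\<close> by (rule Suc_diff_Suc)
  also have "(rho ^^ (length s - i)) s = rotate i s"
    using \<open>i < length s\<close> by (simp add: rho_funpow_conv_rotate)
  finally show "rev (map rho (rotations s)) ! i = map (\<lambda>i. rotate i s) [0..<length s] ! i"
    using \<open>i < length s\<close> by simp
qed simp

lemma mset_rotations_conv_rotate:
  "mset (rotations s) = mset (map (\<lambda>i. rotate i s) [0..<length s])"
  by (metis mset_map_rho_rotations mset_rev rev_map_rho_rotations)

subsection \<open>The order as the multiplicity of a rotation\<close>

lemma funpow_eq_self_iff_least_power_dvd:
  assumes "(f ^^ n) x = x" and "0 < n"
  shows "(f ^^ j) x = x \<longleftrightarrow> least_power f x dvd j"
proof
  assume "least_power f x dvd j"
  then have "(f ^^ j) x = (f ^^ (j mod least_power f x)) x"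
    using least_powerI(1)[OF assms] by (simp only: funpow_mod_eq)
  with \<open>least_power f x dvd j\<close> show "(f ^^ j) x = x" by simp
qed (rule least_power_minimal)

lemma card_multiples_lessThan:
  fixes p n :: nat
  assumes "p dvd n" and "0 < n"
  shows "card {i. i < n \<and> p dvd i} = n div p"
proof -
  from assms obtain t where "n = p * t" and "0 < p" by auto
  then have "{i. i < n \<and> p dvd i} = (\<lambda>j. p * j) ` {..<t}" by auto
  with \<open>n = p * t\<close> \<open>0 < p\<close> show ?thesis by (simp add: card_image inj_on_def)
qed

lemma rho_funpow_eq_self_iff:
  "s \<noteq> [] \<Longrightarrow> (rho ^^ j) s = s \<longleftrightarrow> least_power rho s dvd j"
  by (rule funpow_eq_self_iff_least_power_dvd[where n = "length s"]) simp_all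

lemma cyclic_order_eq_div_least_power:
  assumes "s \<noteq> []"
  shows "cyclic_order s = length s div least_power rho s"
  unfolding cyclic_order_def
proof (rule Max_eqI)
  let ?p = "least_power rho s"
  let ?orders = "{d. 0 < d \<and> d dvd length s \<and> (rho ^^ (length s div d)) s = s}"
  have "0 < length s" using assms by simp
  then show "finite ?orders" by simp
  have "?p dvd length s"
    by (simp flip: rho_funpow_eq_self_iff[OF assms])
  then obtain e where "length s = ?p * e" ..
  moreover from this \<open>0 < length s\<close> have "0 < ?p" and "0 < e" by auto
  ultimately show "length s div ?p \<in> ?orders"
    by (simp add: rho_funpow_eq_self_iff[OF assms])
  fix d assume "d \<in> ?orders"
  then obtain t where "length s = d * t" and "?p dvd t"
    by (auto simp: rho_funpow_eq_self_iff[OF assms])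
  then have "d * ?p \<le> length s"
    using \<open>0 < length s\<close> by (intro dvd_imp_le mult_dvd_mono) auto
  then show "d \<le> length s div ?p"
    using \<open>0 < ?p\<close> by (simp add: less_eq_div_iff_mult_less_eq)
qed

lemma count_rotations_self:
  assumes "s \<noteq> []"
  shows "count (mset (rotations s)) s = cyclic_order s"
proof -
  have "count (mset (rotations s)) s = card {i. i < length s \<and> (rho ^^ i) s = s}"
    by (simp add: rotations_def count_mset count_list_eq_length_filter length_filter_conv_card
        filter_map o_def eq_commute[of s] cong: conj_cong del: mset_map)
  also have "\<dots> = length s div least_power rho s"
    using assms rho_funpow_eq_self_iff[OF assms, of "length s"]
    by (simp add: rho_funpow_eq_self_iff[OF assms] card_multiples_lessThan)
  finally show ?thesis
    by (simp add: cyclic_order_eq_div_least_power[OF assms])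
qed

lemma cyclic_order_cyclic_seq:
  assumes "r \<in> cyclic_seq s"
  shows "cyclic_order r = cyclic_order s"
proof -
  have "(rho ^^ j) ((rho ^^ i) s) = (rho ^^ i) ((rho ^^ j) s)" for i j
    by (metis add.commute comp_apply funpow_add)
  then have "(rho ^^ j) ((rho ^^ i) s) = (rho ^^ i) s \<longleftrightarrow> (rho ^^ j) s = s" for i j
    by (simp add: inj_eq[OF inj_rho_funpow])
  with assms show ?thesis by (auto simp: cyclic_seq_def cyclic_order_def)
qed

lemma count_rotations:
  assumes "r \<in> set (rotations s)"
  shows "count (mset (rotations s)) r = cyclic_order s"
proof -
  have "r \<noteq> []" and "r \<in> cyclic_seq s"
    using assms Nil_notin_rotations[of s] by (auto simp: set_rotations split: if_splits)
  then show ?thesis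
    by (metis count_rotations_self cyclic_order_cyclic_seq mset_rotations_cyclic_seq)
qed

lemma cyclic_order_pos: "s \<noteq> [] \<Longrightarrow> 0 < cyclic_order s"
  by (metis count_mset_gt_0 count_rotations_self self_in_cyclic_seq set_rotations)

subsection \<open>Cyclic prefixes\<close>

text \<open>A prefix of the periodic infinite word \<open>s s s \<dots>\<close>: for \<open>q = 1\<close> a \<open>k\<close>-mer may be
  longer than \<open>s\<close>, so \<open>take\<close> does not suffice.\<close>
definition cyclic_prefix :: "nat \<Rightarrow> 'a list \<Rightarrow> 'a list" where
  "cyclic_prefix l s = map (\<lambda>j. s ! (j mod length s)) [0..<l]"

lemma length_cyclic_prefix [simp]: "length (cyclic_prefix l s) = l"
  by (simp add: cyclic_prefix_def)

lemma nth_cyclic_prefix [simp]: "j < l \<Longrightarrow> cyclic_prefix l s ! j = s ! (j mod length s)"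
  by (simp add: cyclic_prefix_def)

lemma set_cyclic_prefix_subset: "s \<noteq> [] \<Longrightarrow> set (cyclic_prefix l s) \<subseteq> set s"
  by (auto simp: cyclic_prefix_def)

lemma cyclic_prefix_length [simp]: "cyclic_prefix (length s) s = s"
  by (rule nth_equalityI) simp_all

lemma cyclic_prefix_rho:
  assumes "s \<noteq> []"
  shows "cyclic_prefix (Suc l) (rho s) = last s # cyclic_prefix l s"
proof (rule nth_equalityI)
  fix j assume "j < length (cyclic_prefix (Suc l) (rho s))"
  then have "j < Suc l" by simp
  have "rho s ! (Suc i mod length s) = s ! (i mod length s)" for i
    using assms nth_rotate1[of "i mod length s" "rho s"] by (simp add: rho_def mod_Suc_eq)
  with \<open>j < Suc l\<close> assms
  show "cyclic_prefix (Suc l) (rho s) ! j = (last s # cyclic_prefix l s) ! j"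
    by (cases j) (simp_all add: rho_def)
qed simp

lemma cyclic_prefix_rotate:
  assumes "s \<noteq> []"
  shows "cyclic_prefix l (rotate i s) = map (\<lambda>j. s ! ((i + j) mod length s)) [0..<l]"
  using assms by (simp add: cyclic_prefix_def nth_rotate mod_add_right_eq)

lemma cyclic_prefix_conv_take: "cyclic_prefix l s = take l (s @ cyclic_prefix l s)"
  by (rule nth_equalityI) (simp_all add: nth_append flip: le_mod_geq)

lemma take_mono_lex:
  fixes xs ys :: "'a::order list"
  assumes "xs \<le> ys"
  shows "take l xs \<le> take l ys"
  using assms
proof (induction l arbitrary: xs ys)
  case (Suc l)
  then show ?case by (cases xs; cases ys) auto
qed simp

lemma cyclic_prefix_mono:
  fixes r s :: "'a::order list"
  assumes "length r = length s" and "r \<le> s"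
  shows "cyclic_prefix l r \<le> cyclic_prefix l s"
proof (cases "r = s")
  case False
  with assms have "r @ cyclic_prefix l r < s @ cyclic_prefix l s"
    by (auto simp: list_le_def list_less_def intro: lexord_sufI)
  then have "take l (r @ cyclic_prefix l r) \<le> take l (s @ cyclic_prefix l s)"
    by (intro take_mono_lex less_imp_le)
  then show ?thesis
    by (simp only: flip: cyclic_prefix_conv_take)
qed simp

lemma sorted_map_cyclic_prefix:
  fixes xs :: "'a::linorder list list"
  assumes "sorted xs" and "\<And>r. r \<in> set xs \<Longrightarrow> length r = n"
  shows "sorted (map (cyclic_prefix l) xs)"
  using assms by (induction xs) (auto intro: cyclic_prefix_mono)

lemma occurrences_eq_count_rotations:
  "occurrences y s = size {#r \<in># mset (rotations s). cyclic_prefix (length y) r = y#}"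
proof (cases "s = []")
  case False
  then show ?thesis
    by (simp add: occurrences_def mset_rotations_conv_rotate length_filter_conv_card
        cyclic_prefix_rotate filter_map o_def cong: conj_cong flip: mset_filter del: mset_map)
qed (simp add: occurrences_def rotations_def)

lemma occurrences_Cons_eq_count_rotations:
  "occurrences (c # x) s =
    size {#r \<in># mset (rotations s). last r = c \<and> cyclic_prefix (length x) r = x#}"
proof -
  have "occurrences (c # x) s =
      size {#r \<in># mset (map rho (rotations s)). cyclic_prefix (Suc (length x)) r = c # x#}"
    by (simp only: occurrences_eq_count_rotations mset_map_rho_rotations length_Cons)
  also have "\<dots> =
      size {#r \<in># mset (rotations s). cyclic_prefix (Suc (length x)) (rho r) = c # x#}"
    by (simp add: filter_mset_image_mset o_def)
  also have "{#r \<in># mset (rotations s). cyclic_prefix (Suc (length x)) (rho r) = c # x#} =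
      {#r \<in># mset (rotations s). last r = c \<and> cyclic_prefix (length x) r = x#}"
  proof (rule filter_mset_cong0)
    fix r assume "r \<in># mset (rotations s)"
    then have "r \<noteq> []" by auto
    then show "cyclic_prefix (Suc (length x)) (rho r) = c # x \<longleftrightarrow>
        last r = c \<and> cyclic_prefix (length x) r = x"
      by (simp add: cyclic_prefix_rho)
  qed
  finally show ?thesis .
qed

subsection \<open>The sorted table of rotations\<close>

definition bwt_table :: "'a::linorder list \<Rightarrow> 'a list list" where
  "bwt_table s = sort (rotations s)"

definition reduced_bwt_table :: "'a::linorder list \<Rightarrow> 'a list list" where
  "reduced_bwt_table s = sorted_list_of_set (set (rotations s))"

definition reduced_bwt :: "'a::linorder list \<Rightarrow> 'a list" where
  "reduced_bwt s = map last (reduced_bwt_table s)"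

lemma mset_bwt_table [simp]: "mset (bwt_table s) = mset (rotations s)"
  by (simp add: bwt_table_def)

lemma set_bwt_table [simp]: "set (bwt_table s) = set (rotations s)"
  by (simp add: bwt_table_def)

lemma set_reduced_bwt_table [simp]: "set (reduced_bwt_table s) = set (rotations s)"
  by (simp add: reduced_bwt_table_def)

lemma length_bwt_table [simp]: "length (bwt_table s) = length s"
  by (simp add: bwt_table_def)

lemma bwt_conv_table: "bwt s = map last (bwt_table s)"
  by (simp add: bwt_def bwt_table_def rotations_def)

lemma bwt_table_eq_letter_power:
  "bwt_table s = letter_power (cyclic_order s) (reduced_bwt_table s)"
  unfolding bwt_table_def reduced_bwt_table_def
  by (rule sort_eq_letter_power) (rule count_rotations)

lemma bwt_eq_letter_power: "bwt s = letter_power (cyclic_order s) (reduced_bwt s)"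
  by (simp add: bwt_conv_table bwt_table_eq_letter_power reduced_bwt_def map_letter_power)

lemma set_reduced_bwt_subset: "set (reduced_bwt s) \<subseteq> set s"
proof -
  have "last r \<in> set s" if "r \<in> set (rotations s)" for r
    using that last_in_set[of r] set_of_rotation[OF that] by (cases "r = []") simp_all
  then show ?thesis by (auto simp: reduced_bwt_def)
qed

subsection \<open>Inverting the Burrows--Wheeler transform\<close>

lemma map_cyclic_prefix_Suc_bwt_table:
  "map (cyclic_prefix (Suc l)) (bwt_table s) =
    sort (map2 (#) (map last (bwt_table s)) (map (cyclic_prefix l) (bwt_table s)))"
proof (rule properties_for_sort[symmetric])
  have "map2 (#) (map last (bwt_table s)) (map (cyclic_prefix l) (bwt_table s)) =
      map (\<lambda>r. last r # cyclic_prefix l r) (bwt_table s)"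
    by (simp add: zip_map_map zip_same_conv_map)
  also have "\<dots> = map (cyclic_prefix (Suc l) \<circ> rho) (bwt_table s)"
    by (rule map_cong) (auto intro!: cyclic_prefix_rho[symmetric])
  also have "mset \<dots> = image_mset (cyclic_prefix (Suc l)) (mset (map rho (rotations s)))"
    by (simp add: image_mset.compositionality)
  also have "\<dots> = mset (map (cyclic_prefix (Suc l)) (bwt_table s))"
    unfolding mset_map_rho_rotations by simp
  finally show "mset (map (cyclic_prefix (Suc l)) (bwt_table s)) =
      mset (map2 (#) (map last (bwt_table s)) (map (cyclic_prefix l) (bwt_table s)))" ..
  show "sorted (map (cyclic_prefix (Suc l)) (bwt_table s))"
    by (rule sorted_map_cyclic_prefix[where n = "length s"])
      (simp_all add: bwt_table_def length_of_rotation)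
qed

lemma map_cyclic_prefix_bwt_table_eq_letter_power:
  assumes "map last (bwt_table s) = letter_power e b"
  shows "\<exists>u. length u = length b \<and> map (cyclic_prefix l) (bwt_table s) = letter_power e u"
proof (induction l)
  case 0
  have "length s = e * length b"
    using arg_cong[OF assms, of length] by simp
  then have "map (cyclic_prefix 0) (bwt_table s) = replicate (e * length b) []"
    by (intro replicate_eqI) (auto simp: cyclic_prefix_def)
  then show ?case
    by (metis length_replicate letter_power_replicate)
next
  case (Suc l)
  then obtain u where "length u = length b"
    and "map (cyclic_prefix l) (bwt_table s) = letter_power e u"
    by auto
  then show ?case
    by (intro exI[of _ "sort (map2 (#) b u)"])
      (simp add: map_cyclic_prefix_Suc_bwt_table assms map2_letter_power sort_letter_power)
qed

lemma letter_power_exponent_dvd_cyclic_order: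
  assumes "s \<noteq> []" and "map last (bwt_table s) = letter_power e b"
  shows "e dvd cyclic_order s"
proof -
  have "map (cyclic_prefix (length s)) (bwt_table s) = bwt_table s"
    by (rule map_idI) (metis cyclic_prefix_length length_of_rotation set_bwt_table)
  then obtain u where "bwt_table s = letter_power e u"
    using map_cyclic_prefix_bwt_table_eq_letter_power[OF assms(2)] by metis
  then have "mset (rotations s) = repeat_mset e (mset u)"
    by (metis mset_bwt_table mset_letter_power)
  then have "cyclic_order s = e * count (mset u) s"
    by (simp flip: count_rotations_self[OF assms(1)])
  then show ?thesis by simp
qed

lemma reduced_bwt_in_non_letter_powers:
  assumes "s \<noteq> []" and "set s \<subseteq> alphabet q"
  shows "reduced_bwt s \<in> non_letter_powers q"
proof -
  have "i = 1" if "reduced_bwt s = letter_power i b" for i b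
  proof -
    have "map last (bwt_table s) = letter_power (cyclic_order s * i) b"
      using that by (metis bwt_conv_table bwt_eq_letter_power letter_power_letter_power)
    then have "cyclic_order s * i dvd cyclic_order s"
      by (rule letter_power_exponent_dvd_cyclic_order[OF assms(1)])
    then show "i = 1" using cyclic_order_pos[OF assms(1)] by simp
  qed
  moreover have "length s = cyclic_order s * length (reduced_bwt s)"
    using bwt_eq_letter_power[of s]
    by (metis bwt_conv_table length_bwt_table length_letter_power length_map)
  then have "reduced_bwt s \<noteq> []"
    using assms(1) by auto
  ultimately show ?thesis
    using set_reduced_bwt_subset[of s] assms(2) by (auto simp: non_letter_powers_def)
qed

subsection \<open>Blocks of rows with a common prefix\<close>

lemma filter_append_filter_neq_min:
  fixes f :: "'a \<Rightarrow> 'b::linorder"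
  assumes "sorted (map f xs)" and "\<And>x. x \<in> set xs \<Longrightarrow> k \<le> f x"
  shows "filter (\<lambda>x. f x = k) xs @ filter (\<lambda>x. f x \<noteq> k) xs = xs"
  using assms
proof (induction xs)
  case (Cons x xs)
  show ?case
  proof (cases "f x = k")
    case False
    with Cons.prems have "\<forall>y\<in>set (x # xs). f y \<noteq> k" by fastforce
    then show ?thesis by (simp add: filter_id_conv filter_empty_conv)
  qed (use Cons in simp)
qed simp

lemma concat_filter_key:
  fixes f :: "'a \<Rightarrow> 'b::linorder"
  assumes "sorted (map f xs)" and "sorted_wrt (<) ks" and "f ` set xs \<subseteq> set ks"
  shows "concat (map (\<lambda>k. filter (\<lambda>x. f x = k) xs) ks) = xs"
  using assms
proof (induction ks arbitrary: xs)
  case (Cons k ks)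
  define ys where "ys = filter (\<lambda>x. f x \<noteq> k) xs"
  have "concat (map (\<lambda>k. filter (\<lambda>x. f x = k) ys) ks) = ys"
    using Cons.prems by (intro Cons.IH) (auto simp: ys_def intro: sorted_filter)
  moreover have "filter (\<lambda>x. f x = k') ys = filter (\<lambda>x. f x = k') xs" if "k' \<in> set ks" for k'
    using that Cons.prems(2) by (auto simp: ys_def intro: filter_cong)
  ultimately have "concat (map (\<lambda>k. filter (\<lambda>x. f x = k) xs) ks) = ys"
    by (simp cong: map_cong)
  moreover have "filter (\<lambda>x. f x = k) xs @ ys = xs"
    unfolding ys_def
  proof (rule filter_append_filter_neq_min)
    fix x assume "x \<in> set xs"
    with Cons.prems(3) have "f x \<in> set (k # ks)" by blast
    with Cons.prems(2) show "k \<le> f x" by auto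
  qed (rule Cons.prems(1))
  ultimately show ?case by simp
qed simp

definition bwt_block :: "'a::linorder list \<Rightarrow> 'a list \<Rightarrow> 'a list" where
  "bwt_block s x =
    map last (filter (\<lambda>r. cyclic_prefix (length x) r = x) (reduced_bwt_table s))"

lemma set_bwt_block_subset: "set (bwt_block s x) \<subseteq> set s"
  using set_reduced_bwt_subset[of s] by (auto simp: bwt_block_def reduced_bwt_def)

lemma count_bwt_block: "cyclic_order s * count_list (bwt_block s x) c = occurrences (c # x) s"
proof -
  have "letter_power (cyclic_order s) (bwt_block s x) =
      map last (filter (\<lambda>r. cyclic_prefix (length x) r = x) (bwt_table s))"
    by (simp add: bwt_block_def bwt_table_eq_letter_power map_letter_power filter_letter_power)
  then have "repeat_mset (cyclic_order s) (mset (bwt_block s x)) =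
      image_mset last {#r \<in># mset (rotations s). cyclic_prefix (length x) r = x#}"
    by (simp flip: mset_letter_power)
  then have "cyclic_order s * count_list (bwt_block s x) c =
      count (image_mset last {#r \<in># mset (rotations s). cyclic_prefix (length x) r = x#}) c"
    by (metis count_mset count_repeat_mset)
  also have "\<dots> = occurrences (c # x) s"
    by (simp add: count_conv_size_mset filter_mset_image_mset filter_filter_mset
        occurrences_Cons_eq_count_rotations conj_commute)
  finally show ?thesis .
qed

lemma bwt_block_in_balanced_words:
  assumes "s \<noteq> []" and "set s \<subseteq> alphabet q"
    and "\<And>c. c \<in> alphabet q \<Longrightarrow> occurrences (c # x) s = m"
  shows "bwt_block s x \<in> balanced_words (m div cyclic_order s) q"
proof -
  have letters: "set (bwt_block s x) \<subseteq> alphabet q"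
    using set_bwt_block_subset assms(2) by blast
  have counts: "count_list (bwt_block s x) c = m div cyclic_order s" if "c \<in> alphabet q" for c
    using count_bwt_block[of s x c] assms(3)[OF that] cyclic_order_pos[OF assms(1)] by auto
  have "length (bwt_block s x) = sum (count_list (bwt_block s x)) (alphabet q)"
    using letters by (simp add: sum_count_set alphabet_def)
  with letters counts show ?thesis
    by (simp add: balanced_words_def alphabet_def)
qed

lemma finite_kmers [simp]: "finite (kmers q l)"
  by (simp add: kmers_def alphabet_def finite_lists_length_eq)

lemma card_kmers: "card (kmers q l) = q ^ l"
  by (simp add: kmers_def alphabet_def card_lists_length_eq)

lemma cyclic_prefix_in_kmers:
  "s \<noteq> [] \<Longrightarrow> set s \<subseteq> alphabet q \<Longrightarrow> cyclic_prefix l s \<in> kmers q l"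
  using set_cyclic_prefix_subset[of s l] by (auto simp: kmers_def)

lemma reduced_bwt_eq_concat_bwt_blocks:
  assumes "set s \<subseteq> alphabet q"
  shows "reduced_bwt s = concat (map (bwt_block s) (sorted_list_of_set (kmers q l)))"
proof -
  let ?rows = "\<lambda>x. filter (\<lambda>r. cyclic_prefix l r = x) (reduced_bwt_table s)"
  have "concat (map ?rows (sorted_list_of_set (kmers q l))) = reduced_bwt_table s"
  proof (rule concat_filter_key)
    show "sorted (map (cyclic_prefix l) (reduced_bwt_table s))"
      by (rule sorted_map_cyclic_prefix[where n = "length s"])
        (simp_all add: reduced_bwt_table_def length_of_rotation)
    have "cyclic_prefix l r \<in> kmers q l" if "r \<in> set (rotations s)" for r
      using that assms by (intro cyclic_prefix_in_kmers) (auto simp: set_of_rotation)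
    then show "cyclic_prefix l ` set (reduced_bwt_table s)
        \<subseteq> set (sorted_list_of_set (kmers q l))"
      by auto
  qed simp
  then have "reduced_bwt s = map last (concat (map ?rows (sorted_list_of_set (kmers q l))))"
    by (simp add: reduced_bwt_def)
  also have "\<dots> = concat (map (\<lambda>x. map last (?rows x)) (sorted_list_of_set (kmers q l)))"
    by (simp add: map_concat o_def)
  also have "map (\<lambda>x. map last (?rows x)) (sorted_list_of_set (kmers q l)) =
      map (bwt_block s) (sorted_list_of_set (kmers q l))"
  proof (rule map_cong)
    fix x assume "x \<in> set (sorted_list_of_set (kmers q l))"
    then have "x \<in> kmers q l" by simp
    then have "length x = l" by (simp add: kmers_def)
    then show "map last (?rows x) = bwt_block s x" by (simp add: bwt_block_def)
  qed simp
  finally show ?thesis .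
qed

lemma reduced_bwt_in_concat_power:
  assumes "s \<noteq> []" and "set s \<subseteq> alphabet q"
    and "\<And>y. y \<in> kmers q (Suc l) \<Longrightarrow> occurrences y s = m"
  shows "reduced_bwt s \<in> concat_power (balanced_words (m div cyclic_order s) q) (q ^ l)"
proof -
  have "bwt_block s x \<in> balanced_words (m div cyclic_order s) q" if "x \<in> kmers q l" for x
  proof (rule bwt_block_in_balanced_words[OF assms(1,2)])
    fix c assume "c \<in> alphabet q"
    with that have "c # x \<in> kmers q (Suc l)" by (simp add: kmers_def)
    then show "occurrences (c # x) s = m" by (rule assms(3))
  qed
  then show ?thesis
    unfolding concat_power_def reduced_bwt_eq_concat_bwt_blocks[OF assms(2), of l]
    by (auto simp: card_kmers intro!: exI[of _ "map (bwt_block s) _"])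
qed

subsection \<open>Multi de Bruijn sequences\<close>

lemma cyclic_seq_in_multi_de_bruijn_iff:
  "cyclic_seq s \<in> multi_de_bruijn m q k \<longleftrightarrow>
    set s \<subseteq> alphabet q \<and> (\<forall>y\<in>kmers q k. occurrences y s = m)"
proof
  assume "cyclic_seq s \<in> multi_de_bruijn m q k"
  then obtain t where "cyclic_seq s = cyclic_seq t" and "set t \<subseteq> alphabet q"
    and "\<forall>y\<in>kmers q k. occurrences y t = m"
    by (auto simp: multi_de_bruijn_def)
  moreover from \<open>cyclic_seq s = cyclic_seq t\<close> have "s \<in> cyclic_seq t"
    using self_in_cyclic_seq by blast
  ultimately show "set s \<subseteq> alphabet q \<and> (\<forall>y\<in>kmers q k. occurrences y s = m)"
    by (simp add: set_of_cyclic_seq occurrences_eq_count_rotations mset_rotations_cyclic_seq)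
qed (auto simp: multi_de_bruijn_def)

lemma cyclic_seq_in_multi_de_bruijn_of_order_iff:
  "cyclic_seq s \<in> multi_de_bruijn_of_order d m q k \<longleftrightarrow>
    cyclic_seq s \<in> multi_de_bruijn m q k \<and> cyclic_order s = d"
proof
  assume "cyclic_seq s \<in> multi_de_bruijn_of_order d m q k"
  then obtain t where "cyclic_seq s = cyclic_seq t"
    and "cyclic_seq t \<in> multi_de_bruijn m q k" and "cyclic_order t = d"
    by (auto simp: multi_de_bruijn_of_order_def)
  moreover from \<open>cyclic_seq s = cyclic_seq t\<close> have "s \<in> cyclic_seq t"
    using self_in_cyclic_seq by blast
  ultimately show "cyclic_seq s \<in> multi_de_bruijn m q k \<and> cyclic_order s = d"
    by (simp add: cyclic_order_cyclic_seq)
qed (auto simp: multi_de_bruijn_of_order_def)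

lemma multi_de_bruijn_nonempty:
  assumes "cyclic_seq s \<in> multi_de_bruijn m q k" and "m \<ge> 1" and "q \<ge> 1"
  shows "s \<noteq> []"
proof
  assume "s = []"
  have "replicate k 0 \<in> kmers q k"
    using assms(3) by (auto simp: kmers_def alphabet_def)
  then have "occurrences (replicate k 0) s = m"
    using assms(1) by (simp add: cyclic_seq_in_multi_de_bruijn_iff)
  with \<open>s = []\<close> assms(2) show False by (simp add: occurrences_def)
qed

theorem theorem9:
  fixes m q k d :: nat and s :: "nat list"
  assumes "m \<ge> 1" and "q \<ge> 1" and "k \<ge> 1"
    and "d \<ge> 1" and "d dvd m"
    and "cyclic_seq s \<in> multi_de_bruijn_of_order d m q k"
  shows "\<exists>a. bwt s = letter_power d a \<and>
             a \<in> concat_power (balanced_words (m div d) q) (q ^ (k - 1)) \<inter> non_letter_powers q"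
proof -
  have order: "cyclic_order s = d" and de_bruijn: "cyclic_seq s \<in> multi_de_bruijn m q k"
    using assms(6) by (simp_all add: cyclic_seq_in_multi_de_bruijn_of_order_iff)
  then have letters: "set s \<subseteq> alphabet q"
    and kmer_counts: "\<And>y. y \<in> kmers q (Suc (k - 1)) \<Longrightarrow> occurrences y s = m"
    using assms(3) by (simp_all add: cyclic_seq_in_multi_de_bruijn_iff)
  have "s \<noteq> []"
    using de_bruijn assms(1,2) by (rule multi_de_bruijn_nonempty)
  have "bwt s = letter_power d (reduced_bwt s)"
    using bwt_eq_letter_power[of s] order by simp
  moreover have "reduced_bwt s \<in> concat_power (balanced_words (m div d) q) (q ^ (k - 1))"
    using reduced_bwt_in_concat_power[OF \<open>s \<noteq> []\<close> letters kmer_counts] order by simp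
  moreover have "reduced_bwt s \<in> non_letter_powers q"
    using \<open>s \<noteq> []\<close> letters by (rule reduced_bwt_in_non_letter_powers)
  ultimately show ?thesis by blast
qed

end
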